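(* For every integer $m\ge 1$, the minimum size of a $1$-perfect bitrade in the Hamming graph $H(3m+1,3)$ is $2^{m+1}\cdot 3^{m}$. That is, there exists a $1$-perfect bitrade in $H(3m+1,3)$ of size $2^{m+1}\cdot 3^m$, and every $1$-perfect bitrade in $H(3m+1,3)$ has size at least $2^{m+1}\cdot 3^m$.
   Context: The Hamming graph $H(n,q)$ has vertex set $\{0,1,\ldots,q-1\}^n$, and two vertices are adjacent if they differ in exactly one coordinate. For a vertex $x$ of a graph $G=(V,E)$, let $N(x)$ be the set of neighbors of $x$ and $B(x)=N(x)\cup\{x\}$. Let $T_0,T_1$ be two disjoint nonempty subsets of $V$. The ordered pair $(T_0,T_1)$ is called a $1$-perfect bitrade in $G$ if for every vertex $x\in V$ the set $B(x)$ either contains exactly one element of $T_0$ and exactly one element of $T_1$, or contains no element of $T_0\cup T_1$. The size of a $1$-perfect bitrade $(T_0,T_1)$ is $|T_0|+|T_1|$. *)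

theory Defs
  imports Complex_Main
begin

text \<open>A graph is a pair \<open>(V, E)\<close> of a vertex set and an adjacency relation.\<close>

type_synonym 'a graph = "'a set \<times> ('a \<Rightarrow> 'a \<Rightarrow> bool)"

definition verts :: "'a graph \<Rightarrow> 'a set" where
  "verts G = fst G"

definition adj :: "'a graph \<Rightarrow> 'a \<Rightarrow> 'a \<Rightarrow> bool" where
  "adj G = snd G"

definition neighbors :: "'a graph \<Rightarrow> 'a \<Rightarrow> 'a set" where
  "neighbors G x = {y \<in> verts G. adj G x y}"

definition closed_nbhd :: "'a graph \<Rightarrow> 'a \<Rightarrow> 'a set" where
  "closed_nbhd G x = neighbors G x \<union> {x}"

definition perfect_bitrade :: "'a graph \<Rightarrow> 'a set \<Rightarrow> 'a set \<Rightarrow> bool" where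
  "perfect_bitrade G T0 T1 \<longleftrightarrow>
     T0 \<subseteq> verts G \<and> T1 \<subseteq> verts G \<and> T0 \<noteq> {} \<and> T1 \<noteq> {} \<and> T0 \<inter> T1 = {} \<and>
     (\<forall>x \<in> verts G.
        card (closed_nbhd G x \<inter> T0) = 1 \<and> card (closed_nbhd G x \<inter> T1) = 1 \<or>
        closed_nbhd G x \<inter> (T0 \<union> T1) = {})"

definition bitrade_size :: "'a set \<Rightarrow> 'a set \<Rightarrow> nat" where
  "bitrade_size T0 T1 = card T0 + card T1"

text \<open>The vertices of \<open>H(n, q)\<close> are the words of length \<open>n\<close> over \<open>{0, \<dots>, q - 1}\<close>, as lists.\<close>

definition hamming_graph :: "nat \<Rightarrow> nat \<Rightarrow> nat list graph" where
  "hamming_graph n q =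
     ({x. length x = n \<and> set x \<subseteq> {..<q}},
      \<lambda>x y. card {i. i < n \<and> x ! i \<noteq> y ! i} = 1)"

lemma finite_verts_hamming_graph: "finite (verts (hamming_graph n q))"
proof -
  have "finite {x. set x \<subseteq> {..<q} \<and> length x = n}"
    by (rule finite_lists_length_eq) simp
  then show ?thesis
    by (simp add: verts_def hamming_graph_def conj_commute)
qed

lemma adj_hamming_graph_irrefl: "\<not> adj (hamming_graph n q) x x"
  by (simp add: adj_def hamming_graph_def)

lemma adj_hamming_graph_sym: "adj (hamming_graph n q) x y \<longleftrightarrow> adj (hamming_graph n q) y x"
  by (simp add: adj_def hamming_graph_def eq_commute)

end

theory Submission
  imports Defs "HOL-Library.FuncSet"
begin

text \<open>
  Lower bound. Let \<open>f\<close> be the indicator of \<open>T0\<close> minus the indicator of \<open>T1\<close>. The bitrade condition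
  makes \<open>f\<close> sum to zero over every closed neighbourhood, so \<open>f\<close> is an eigenfunction of the adjacency
  matrix for the eigenvalue \<open>-1\<close>. Products over a set \<open>W\<close> of coordinates of one-variable functions
  with sum zero are eigenfunctions for \<open>n * (q - 1) - q * card W\<close>; hence \<open>f\<close> is orthogonal to all
  of them except those with \<open>card W = i\<close>, where \<open>n * (q - 1) + 1 = q * i\<close>. This step is
  \<open>bitrade_orthogonal_character\<close>.

  What matters about \<open>f\<close> is only its orthogonality to all such products with \<open>card W < i\<close> or with
  fewer than \<open>d = n - i\<close> coordinates outside \<open>W\<close>. This property survives the restriction to a layer
  (one coordinate fixed) with both parameters lowered by one (\<open>spectral_layer\<close>). If \<open>d > 0\<close>
  and \<open>f\<close> is nonzero, some coordinate has all its \<open>q\<close> layers nonzero (\<open>full_coordinate\<close>);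
  if \<open>d = 0\<close> and \<open>i > 0\<close>, some coordinate has at least two nonzero layers (\<open>split_coordinate\<close>). So
  passing to layers \<open>i\<close> times multiplies the support by \<open>q\<close> in \<open>d\<close> of the steps and by 2 in the other
  \<open>i - d\<close>, which gives at least \<open>q ^ d * 2 ^ (i - d)\<close> nonzero values (\<open>support_bound\<close>). For
  \<open>H(3 * m + 1, 3)\<close> one has \<open>i = 2 * m + 1\<close> and \<open>d = m\<close>.

  Sharpness. On \<open>H(3, 3)\<close> the sign of a permutation, extended by zero to the words with a repeated
  letter, vanishes on the closed neighbourhood of a constant word, and every word with exactly two
  equal letters is adjacent to one even and one odd permutation. Multiplying \<open>m\<close> copies of this
  function and the function with values \<open>1, 0, -1\<close> on \<open>H(1, 3)\<close> gives a function whose positive and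
  negative parts form a bitrade with \<open>6 ^ m * 2\<close> vertices (\<open>signed_word_nbhd\<close>).
\<close>

section \<open>Functions with restricted spectrum and their layers\<close>

text \<open>
  Words are functions on a finite set of coordinates, so that any coordinate can be deleted without
  renumbering the others.
\<close>

definition words :: "nat \<Rightarrow> 'a set \<Rightarrow> ('a \<Rightarrow> nat) set" where
  "words q I = (I \<rightarrow>\<^sub>E {..<q})"

definition corr :: "nat \<Rightarrow> 'a set \<Rightarrow> 'a set \<Rightarrow> ('a \<Rightarrow> nat \<Rightarrow> int) \<Rightarrow> (('a \<Rightarrow> nat) \<Rightarrow> int) \<Rightarrow> int" where
  "corr q I W u f = (\<Sum>x\<in>words q I. f x * (\<Prod>r\<in>W. u r (x r)))"

text \<open>
  In terms of the eigenspaces of the Hamming graph on the coordinates \<open>I\<close>: the function has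
  components only in those indexed by \<open>i, \<dots>, card I - d\<close>. The index \<open>j\<close> eigenspace is spanned by the
  products of sum-zero functions over \<open>j\<close> coordinates.
\<close>

definition spectral :: "nat \<Rightarrow> 'a set \<Rightarrow> nat \<Rightarrow> nat \<Rightarrow> (('a \<Rightarrow> nat) \<Rightarrow> int) \<Rightarrow> bool" where
  "spectral q I i d f \<longleftrightarrow>
     (\<forall>W u. W \<subseteq> I \<longrightarrow> (\<forall>r\<in>W. (\<Sum>a<q. u r a) = 0) \<longrightarrow> card W < i \<or> card (I - W) < d \<longrightarrow>
        corr q I W u f = 0)"

definition support :: "nat \<Rightarrow> 'a set \<Rightarrow> (('a \<Rightarrow> nat) \<Rightarrow> int) \<Rightarrow> ('a \<Rightarrow> nat) set" where
  "support q I f = {x \<in> words q I. f x \<noteq> 0}"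

definition layer :: "'a \<Rightarrow> nat \<Rightarrow> (('a \<Rightarrow> nat) \<Rightarrow> int) \<Rightarrow> ('a \<Rightarrow> nat) \<Rightarrow> int" where
  "layer r k f = (\<lambda>x. f (x(r := k)))"

lemma finite_words: "finite I \<Longrightarrow> finite (words q I)"
  unfolding words_def by (rule finite_PiE) auto

lemma finite_support: "finite I \<Longrightarrow> finite (support q I f)"
  by (simp add: support_def finite_words)

lemma sum_words_insert:
  fixes F :: "('a \<Rightarrow> nat) \<Rightarrow> 'b::comm_monoid_add"
  assumes "r \<notin> J"
  shows "(\<Sum>x\<in>words q (insert r J). F x) = (\<Sum>k<q. \<Sum>x\<in>words q J. F (x(r := k)))"
proof -
  have "(\<Sum>x\<in>words q (insert r J). F x) =
      (\<Sum>p\<in>{..<q} \<times> words q J. F ((snd p)(r := fst p)))"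
    unfolding words_def PiE_insert_eq
    by (subst sum.reindex) (auto intro!: inj_combinator assms simp: case_prod_beta comp_def)
  also have "\<dots> = (\<Sum>k<q. \<Sum>x\<in>words q J. F (x(r := k)))"
    by (simp add: sum.cartesian_product case_prod_beta)
  finally show ?thesis .
qed

lemma card_support_layers:
  assumes "finite J" "r \<notin> J"
  shows "card (support q (insert r J) f) = (\<Sum>k<q. card (support q J (layer r k f)))"
proof -
  have count: "card (support q K g) = (\<Sum>x\<in>words q K. if g x \<noteq> 0 then 1 else 0)"
    if "finite K" for K :: "'a set" and g
    using that unfolding support_def
    by (simp add: sum.If_cases finite_words Int_def)
  show ?thesis
    using assms by (simp add: count sum_words_insert layer_def)
qed

lemma support_layer_nonempty:
  assumes "x \<in> support q (insert r J) f" "r \<notin> J"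
  shows "support q J (layer r (x r) f) \<noteq> {}"
proof -
  have "x(r := undefined) \<in> words q J"
    using assms unfolding support_def words_def by (auto simp: PiE_iff extensional_def)
  then have "x(r := undefined) \<in> support q J (layer r (x r) f)"
    using assms by (simp add: support_def layer_def)
  then show ?thesis by blast
qed

lemma corr_insert_coordinate:
  assumes "r \<notin> J" "W \<subseteq> J"
  shows "corr q (insert r J) W u f = (\<Sum>k<q. corr q J W u (layer r k f))"
proof -
  have "(\<Prod>s\<in>W. u s ((x(r := k)) s)) = (\<Prod>s\<in>W. u s (x s))" for x k
    using assms by (intro prod.cong) auto
  then show ?thesis
    using assms(1) by (simp add: corr_def sum_words_insert layer_def)
qed

lemma corr_insert_factor:
  assumes "r \<notin> J" "W \<subseteq> J" "finite J"
  shows "corr q (insert r J) (insert r W) (u(r := v)) f =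
    (\<Sum>k<q. v k * corr q J W u (layer r k f))"
proof -
  have "finite W" "r \<notin> W" using assms finite_subset by blast+
  have "(\<Prod>s\<in>W. (u(r := v)) s ((x(r := k)) s)) = (\<Prod>s\<in>W. u s (x s))" for x k
    using \<open>r \<notin> W\<close> by (intro prod.cong) auto
  then show ?thesis
    using assms(1) \<open>finite W\<close> \<open>r \<notin> W\<close>
    by (simp add: corr_def sum_words_insert layer_def sum_distrib_left mult_ac)
qed

lemma spectralD:
  assumes "spectral q I i d f" "W \<subseteq> I" "\<forall>r\<in>W. (\<Sum>a<q. u r a) = 0"
    "card W < i \<or> card (I - W) < d"
  shows "corr q I W u f = 0"
  using assms(1)[unfolded spectral_def, THEN spec[of _ W], THEN spec[of _ u]] assms(2-4) by simp

text \<open>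
  The indicator of a letter \<open>k\<close> is, up to the factor \<open>q\<close>, the constant 1 plus the sum-zero function
  \<open>q * [a = k] - 1\<close>. A test product on the remaining coordinates thus extends to two test products
  on all coordinates, one that gains a coordinate outside \<open>W\<close> and one that gains a coordinate in
  \<open>W\<close>. This is why each of the two bounds drops by one.
\<close>

lemma spectral_layer:
  assumes "spectral q (insert r J) (Suc i) d f" "r \<notin> J" "finite J" "k < q"
  shows "spectral q J i (d - 1) (layer r k f)"
  unfolding spectral_def
proof (intro allI impI)
  fix W u
  assume W: "W \<subseteq> J" and u: "\<forall>s\<in>W. (\<Sum>a<q. u s a) = (0::int)"
    and small: "card W < i \<or> card (J - W) < d - 1"
  have fin: "finite W" using W assms(3) by (rule finite_subset)
  have rW: "r \<notin> W" using W assms(2) by blast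
  define v :: "nat \<Rightarrow> int" where "v a = (if a = k then int q else 0) - 1" for a
  have v: "(\<Sum>a<q. v a) = 0"
    using assms(4) by (simp add: v_def sum_subtractf)
  have c1: "card (insert r J - W) = Suc (card (J - W))"
    using rW assms(2,3) by (simp add: insert_Diff_if)
  have c2: "insert r J - insert r W = J - W" using assms(2) by blast
  have "card W < Suc i \<or> card (insert r J - W) < d"
    using small c1 by linarith
  then have "corr q (insert r J) W u f = 0"
    using W by (intro spectralD[OF assms(1) _ u]) auto
  then have A: "(\<Sum>l<q. corr q J W u (layer r l f)) = 0"
    by (simp add: corr_insert_coordinate[OF assms(2) W])
  have "corr q (insert r J) (insert r W) (u(r := v)) f = 0"
  proof -
    have "\<forall>s\<in>insert r W. (\<Sum>a<q. (u(r := v)) s a) = 0"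
      using u v by simp
    moreover have "card (insert r W) < Suc i \<or> card (insert r J - insert r W) < d"
      unfolding c2 using small fin rW by simp linarith
    ultimately show ?thesis
      using W by (intro spectralD[OF assms(1)]) auto
  qed
  then have "(\<Sum>l<q. v l * corr q J W u (layer r l f)) = 0"
    by (simp add: corr_insert_factor[OF assms(2) W assms(3)])
  moreover have "(\<Sum>l<q. v l * corr q J W u (layer r l f)) =
      int q * corr q J W u (layer r k f) - (\<Sum>l<q. corr q J W u (layer r l f))"
  proof -
    have "v l * c = (if l = k then int q * c else 0) - c" for l c
      by (simp add: v_def algebra_simps)
    then show ?thesis using assms(4) by (simp add: sum_subtractf)
  qed
  ultimately show "corr q J W u (layer r k f) = 0"
    using A assms(4) by simp
qed

text \<open>
  Suppose each coordinate \<open>r\<close> has a letter \<open>z r\<close> whose layer is zero. For a point \<open>x\<close> of the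
  support, the factors \<open>[a = x r] - [a = z r]\<close> have sum zero, and on the support, which avoids the
  letters \<open>z r\<close>, their product is the indicator of \<open>x\<close>. Since \<open>d > 0\<close>, the function is orthogonal to
  products over all coordinates, so it vanishes at \<open>x\<close>.
\<close>

lemma full_coordinate:
  assumes "finite I" "spectral q I i d f" "0 < d" "support q I f \<noteq> {}"
  shows "\<exists>r\<in>I. \<forall>k<q. support q (I - {r}) (layer r k f) \<noteq> {}"
proof (rule ccontr)
  assume "\<not> ?thesis"
  then have "\<forall>r\<in>I. \<exists>k. k < q \<and> support q (I - {r}) (layer r k f) = {}" by blast
  then obtain z where z': "\<forall>r\<in>I. z r < q \<and> support q (I - {r}) (layer r (z r) f) = {}"
    by (rule bchoice[THEN exE])
  then have z: "\<And>r. r \<in> I \<Longrightarrow> z r < q"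
      "\<And>r. r \<in> I \<Longrightarrow> support q (I - {r}) (layer r (z r) f) = {}"
    by blast+
  have avoid: "y r \<noteq> z r" if "y \<in> support q I f" "r \<in> I" for y r
  proof
    assume "y r = z r"
    moreover have "insert r (I - {r}) = I" using that(2) by blast
    ultimately show False
      using support_layer_nonempty[of y q r "I - {r}" f] that(1) z(2)[OF that(2)] by simp
  qed
  obtain x where x: "x \<in> support q I f" using assms(4) by blast
  have xw: "x \<in> words q I" and xI: "\<And>r. r \<in> I \<Longrightarrow> x r < q"
    using x by (auto simp: support_def words_def)
  define u :: "'a \<Rightarrow> nat \<Rightarrow> int" where
    "u r a = (if a = x r then 1 else 0) - (if a = z r then 1 else 0)" for r a
  have "corr q I I u f = 0"
  proof -
    have "\<forall>r\<in>I. (\<Sum>a<q. u r a) = 0"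
      using xI z(1) by (simp add: u_def sum_subtractf)
    then show ?thesis using assms(3) by (intro spectralD[OF assms(2)]) auto
  qed
  moreover have "f y * (\<Prod>r\<in>I. u r (y r)) = (if y = x then f x else 0)"
    if y: "y \<in> words q I" for y
  proof (cases "y \<in> support q I f")
    case True
    then have u': "u r (y r) = (if y r = x r then 1 else 0)" if "r \<in> I" for r
      using avoid that by (simp add: u_def)
    show ?thesis
    proof (cases "y = x")
      case True
      then show ?thesis using u' by simp
    next
      case False
      then obtain r where "r \<in> I" "y r \<noteq> x r"
        using y xw unfolding words_def by (metis PiE_ext)
      then have "(\<Prod>r\<in>I. u r (y r)) = 0"
        using u' assms(1) by (intro prod_zero) auto
      then show ?thesis using False by simp
    qed
  next
    case False
    then show ?thesis using x y by (auto simp: support_def)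
  qed
  ultimately have "f x = 0"
    using xw assms(1) by (simp add: corr_def finite_words)
  then show False using x by (simp add: support_def)
qed

text \<open>
  Orthogonality to the empty product says that the values sum to zero, so the support cannot be a
  single point; two of its points differ in some coordinate.
\<close>

lemma split_coordinate:
  assumes "finite I" "spectral q I (Suc i) d f" "support q I f \<noteq> {}"
  shows "\<exists>r\<in>I. \<exists>k<q. \<exists>l<q. k \<noteq> l \<and> support q (I - {r}) (layer r k f) \<noteq> {} \<and>
    support q (I - {r}) (layer r l f) \<noteq> {}"
proof -
  obtain x where x: "x \<in> support q I f" using assms(3) by blast
  have "corr q I {} (\<lambda>_ _. 0) f = 0"
    by (rule spectralD[OF assms(2)]) auto
  then have total: "(\<Sum>y\<in>words q I. f y) = 0" by (simp add: corr_def)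
  have "(\<Sum>y\<in>words q I. f y) = (\<Sum>y\<in>support q I f. f y)"
    using assms(1) by (intro sum.mono_neutral_right) (auto simp: support_def finite_words)
  with total x have "support q I f \<noteq> {x}" by (auto simp: support_def)
  then obtain y where y: "y \<in> support q I f" "y \<noteq> x" using x by blast
  then obtain r where r: "r \<in> I" "y r \<noteq> x r"
    using x unfolding words_def support_def by (metis (mono_tags, lifting) PiE_ext mem_Collect_eq)
  moreover have "y r < q" "x r < q"
    using x y r by (auto simp: support_def words_def)
  ultimately show ?thesis
    using support_layer_nonempty[of _ q r "I - {r}" f] x y
    by (metis Diff_iff insert_Diff insertI1)
qed

text \<open>
  Each layer loses one from \<open>i\<close> and, as long as \<open>d\<close> is positive, one from \<open>d\<close>; so \<open>i - d\<close> is
  constant while full coordinates contribute factors \<open>q\<close>, and then drops to zero while split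
  coordinates contribute factors 2.
\<close>

theorem support_bound:
  assumes "finite I" "spectral q I i d f" "support q I f \<noteq> {}" "d \<le> i"
  shows "q ^ d * 2 ^ (i - d) \<le> card (support q I f)"
  using assms
proof (induction i arbitrary: I d f)
  case 0
  then have "0 < card (support q I f)" by (simp add: card_gt_0_iff finite_support)
  then show ?case using 0 by simp
next
  case (Suc i)
  show ?case
  proof (cases "d = 0")
    case True
    obtain r k l where r: "r \<in> I" and kl: "k < q" "l < q" "k \<noteq> l"
      and ne: "support q (I - {r}) (layer r k f) \<noteq> {}" "support q (I - {r}) (layer r l f) \<noteq> {}"
      using split_coordinate[OF Suc.prems(1-3)] by blast
    have I: "insert r (I - {r}) = I" using r by blast
    have half: "2 ^ i \<le> card (support q (I - {r}) (layer r a f))"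
      if "a < q" "support q (I - {r}) (layer r a f) \<noteq> {}" for a
      using Suc.IH[OF _ spectral_layer[of q r "I - {r}" i d f a]] Suc.prems that True I by simp
    have "2 * 2 ^ i \<le> (\<Sum>a\<in>{k, l}. card (support q (I - {r}) (layer r a f)))"
      using half[OF kl(1) ne(1)] half[OF kl(2) ne(2)] kl(3) by simp
    also have "\<dots> \<le> (\<Sum>a<q. card (support q (I - {r}) (layer r a f)))"
      using kl by (intro sum_mono2) auto
    also have "\<dots> = card (support q I f)"
      using card_support_layers[of "I - {r}" r q f] Suc.prems(1) I by simp
    finally show ?thesis using True by simp
  next
    case False
    obtain r where r: "r \<in> I"
      and ne: "\<And>k. k < q \<Longrightarrow> support q (I - {r}) (layer r k f) \<noteq> {}"
      using full_coordinate[OF Suc.prems(1,2) _ Suc.prems(3)] False by blast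
    have I: "insert r (I - {r}) = I" using r by blast
    have part: "q ^ (d - 1) * 2 ^ (i - (d - 1)) \<le> card (support q (I - {r}) (layer r k f))"
      if "k < q" for k
      using Suc.IH[OF _ spectral_layer[of q r "I - {r}" i d f k] ne[OF that]] Suc.prems that I
      by simp
    have "q ^ d * 2 ^ (Suc i - d) = (\<Sum>k<q. q ^ (d - 1) * 2 ^ (i - (d - 1)))"
      using False by (cases d) auto
    also have "\<dots> \<le> (\<Sum>k<q. card (support q (I - {r}) (layer r k f)))"
      by (rule sum_mono) (use part in auto)
    also have "\<dots> = card (support q I f)"
      using card_support_layers[of "I - {r}" r q f] Suc.prems(1) I by simp
    finally show ?thesis .
  qed
qed

section \<open>Bitrades as eigenfunctions\<close>

lemma verts_hamming_iff: "x \<in> verts (hamming_graph n q) \<longleftrightarrow> length x = n \<and> set x \<subseteq> {..<q}"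
  by (simp add: verts_def hamming_graph_def)

lemma Cons_verts_hamming:
  "a # x \<in> verts (hamming_graph (Suc n) q) \<longleftrightarrow> a < q \<and> x \<in> verts (hamming_graph n q)"
  by (auto simp: verts_hamming_iff)

lemma adj_hamming_Cons:
  "adj (hamming_graph (Suc n) q) (a # x) (b # y) \<longleftrightarrow>
     (if a = b then adj (hamming_graph n q) x y else \<forall>i<n. x ! i = y ! i)"
proof -
  let ?D = "{i. i < n \<and> x ! i \<noteq> y ! i}"
  have "{i. i < Suc n \<and> (a # x) ! i \<noteq> (b # y) ! i} = (if a = b then {} else {0}) \<union> Suc ` ?D"
    (is "?L = ?R")
  proof (rule set_eqI)
    show "i \<in> ?L \<longleftrightarrow> i \<in> ?R" for i by (cases i) auto
  qed
  also have "card ?R = (if a = b then 0 else 1) + card ?D"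
    by (subst card_Un_disjoint) (auto simp: card_image)
  finally have "card ?L = (if a = b then 0 else 1) + card ?D" .
  moreover have "card ?D = 0 \<longleftrightarrow> (\<forall>i<n. x ! i = y ! i)"
    by auto
  ultimately show ?thesis
    by (simp add: adj_def hamming_graph_def)
qed

lemma neighbors_hamming_Cons:
  assumes "a # x \<in> verts (hamming_graph (Suc n) q)"
  shows "neighbors (hamming_graph (Suc n) q) (a # x) =
    (#) a ` neighbors (hamming_graph n q) x \<union> (\<lambda>b. b # x) ` ({..<q} - {a})"
proof (rule set_eqI)
  fix z
  have x: "x \<in> verts (hamming_graph n q)" and "a < q" using assms by (simp_all add: Cons_verts_hamming)
  show "z \<in> neighbors (hamming_graph (Suc n) q) (a # x) \<longleftrightarrow>
    z \<in> (#) a ` neighbors (hamming_graph n q) x \<union> (\<lambda>b. b # x) ` ({..<q} - {a})"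
  proof (cases z)
    case Nil
    then show ?thesis by (auto simp: neighbors_def verts_hamming_iff)
  next
    case (Cons b y)
    have "(\<forall>i<n. x ! i = y ! i) \<longleftrightarrow> y = x" if "y \<in> verts (hamming_graph n q)"
      using that x by (auto simp: verts_hamming_iff list_eq_iff_nth_eq)
    then show ?thesis
      using x \<open>a < q\<close>
      by (cases "a = b") (auto simp: Cons neighbors_def Cons_verts_hamming adj_hamming_Cons)
  qed
qed

lemma finite_neighbors_hamming: "finite (neighbors (hamming_graph n q) x)"
  using finite_verts_hamming_graph[of n q] by (simp add: neighbors_def)

lemma sum_neighbors_hamming:
  fixes h :: "nat list \<Rightarrow> 'b::comm_monoid_add"
  assumes "x \<in> verts (hamming_graph n q)"
  shows "(\<Sum>y\<in>neighbors (hamming_graph n q) x. h y) =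
    (\<Sum>r<n. \<Sum>a\<in>{..<q} - {x ! r}. h (x[r := a]))"
  using assms
proof (induction n arbitrary: x h)
  case 0
  have "neighbors (hamming_graph 0 q) x = {}"
    by (auto simp: neighbors_def adj_def hamming_graph_def)
  then show ?case by simp
next
  case (Suc n)
  then obtain a y where x: "x = a # y" by (cases x) (auto simp: verts_hamming_iff)
  then have y: "y \<in> verts (hamming_graph n q)" using Suc.prems by (simp add: Cons_verts_hamming)
  have "(\<Sum>z\<in>neighbors (hamming_graph (Suc n) q) x. h z) =
     (\<Sum>z\<in>(#) a ` neighbors (hamming_graph n q) y. h z) +
     (\<Sum>z\<in>(\<lambda>b. b # y) ` ({..<q} - {a}). h z)"
    using neighbors_hamming_Cons[of a y n q] Suc.prems x
    by (subst sum.union_disjoint[symmetric]) (auto simp: finite_neighbors_hamming)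
  also have "\<dots> = (\<Sum>z\<in>neighbors (hamming_graph n q) y. h (a # z)) +
     (\<Sum>b\<in>{..<q} - {a}. h (b # y))"
    by (simp add: sum.reindex inj_on_def comp_def)
  also have "\<dots> = (\<Sum>r<Suc n. \<Sum>a\<in>{..<q} - {x ! r}. h (x[r := a]))"
    by (simp add: Suc.IH[OF y, of "\<lambda>z. h (a # z)"] sum.lessThan_Suc_shift x add.commute del: sum.lessThan_Suc)
  finally show ?case .
qed

text \<open>
  Changing a coordinate outside \<open>W\<close> reproduces the value \<open>q - 1\<close> times; summing over the changes of
  a coordinate in \<open>W\<close> gives minus the value, because the factor sums to zero over all letters.
\<close>

lemma sum_neighbors_character:
  fixes u :: "nat \<Rightarrow> nat \<Rightarrow> int"
  assumes x: "x \<in> verts (hamming_graph n q)" and W: "W \<subseteq> {..<n}"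
    and u: "\<And>r. r \<in> W \<Longrightarrow> (\<Sum>a<q. u r a) = 0"
  shows "(\<Sum>y\<in>neighbors (hamming_graph n q) x. \<Prod>r\<in>W. u r (y ! r)) =
    (int n * (int q - 1) - int q * int (card W)) * (\<Prod>r\<in>W. u r (x ! r))"
proof -
  let ?\<chi> = "\<lambda>y. \<Prod>r\<in>W. u r (y ! r)"
  have fin: "finite W" using W finite_subset by blast
  have len: "length x = n" and lt: "\<And>r. r < n \<Longrightarrow> x ! r < q"
    using x by (auto simp: verts_hamming_iff subset_iff)
  have line: "(\<Sum>a\<in>{..<q} - {x ! r}. ?\<chi> (x[r := a])) =
      ((int q - 1) - (if r \<in> W then int q else 0)) * ?\<chi> x" if r: "r < n" for r
  proof (cases "r \<in> W")
    case True
    define c where "c = (\<Prod>s\<in>W - {r}. u s (x ! s))"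
    have *: "?\<chi> (x[r := a]) = u r a * c" for a
    proof -
      have "(\<Prod>s\<in>W - {r}. u s (x[r := a] ! s)) = c"
        unfolding c_def by (intro prod.cong) auto
      then show ?thesis
        using prod.remove[OF fin True, of "\<lambda>s. u s (x[r := a] ! s)"] r len by simp
    qed
    have "(\<Sum>a\<in>{..<q} - {x ! r}. u r a) = - u r (x ! r)"
      using u[OF True] lt[OF r] by (simp add: sum_diff1)
    then have "(\<Sum>a\<in>{..<q} - {x ! r}. ?\<chi> (x[r := a])) = - (u r (x ! r) * c)"
      by (simp add: * flip: sum_distrib_right)
    also have "u r (x ! r) * c = ?\<chi> x" using *[of "x ! r"] by simp
    finally show ?thesis using True by simp
  next
    case False
    then have "?\<chi> (x[r := a]) = ?\<chi> x" for a
      by (intro prod.cong refl) (metis nth_list_update_neq)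
    then show ?thesis using False lt[OF r] by (simp add: of_nat_diff)
  qed
  have "(\<Sum>r<n. if r \<in> W then int q else 0) = int q * int (card W)"
    using W by (simp add: sum.If_cases Int_absorb1)
  then show ?thesis
    by (simp add: sum_neighbors_hamming[OF x] line sum_subtractf flip: sum_distrib_right)
qed

text \<open>
  Symmetry of adjacency allows to evaluate the sum of \<open>f y\<close> times the character at \<open>x\<close>, over pairs
  at distance at most 1, in two ways: the bitrade condition makes it zero, and the eigenvalue
  equation makes it a multiple of the inner product, by a factor that is nonzero unless \<open>card W\<close> is
  the one exceptional weight.
\<close>

lemma bitrade_orthogonal_character:
  fixes u :: "nat \<Rightarrow> nat \<Rightarrow> int"
  assumes bt: "perfect_bitrade (hamming_graph n q) T0 T1"
    and W: "W \<subseteq> {..<n}" and u: "\<And>r. r \<in> W \<Longrightarrow> (\<Sum>a<q. u r a) = 0"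
    and weight: "int n * (int q - 1) + 1 \<noteq> int q * int (card W)"
  shows "(\<Sum>x\<in>verts (hamming_graph n q).
    (of_bool (x \<in> T0) - of_bool (x \<in> T1)) * (\<Prod>r\<in>W. u r (x ! r))) = 0"
proof -
  let ?G = "hamming_graph n q" and ?\<chi> = "\<lambda>y. \<Prod>r\<in>W. u r (y ! r)"
  let ?V = "verts ?G"
  define f :: "nat list \<Rightarrow> int" where "f x = of_bool (x \<in> T0) - of_bool (x \<in> T1)" for x
  define c where "c = int n * (int q - 1) + 1 - int q * int (card W)"
  have finV: "finite ?V" by (rule finite_verts_hamming_graph)
  have cn: "closed_nbhd ?G x = {y \<in> ?V. y = x \<or> adj ?G x y}" if "x \<in> ?V" for x
    using that by (auto simp: closed_nbhd_def neighbors_def)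
  have finB: "finite (closed_nbhd ?G x)" for x
    by (simp add: closed_nbhd_def finite_neighbors_hamming)
  have balance: "(\<Sum>y\<in>closed_nbhd ?G x. f y) = 0" if x: "x \<in> ?V" for x
  proof -
    have "(\<Sum>y\<in>closed_nbhd ?G x. f y) =
        int (card (closed_nbhd ?G x \<inter> T0)) - int (card (closed_nbhd ?G x \<inter> T1))"
      by (simp add: f_def sum_subtractf sum.If_cases finB of_bool_def Int_def)
    moreover have "card (closed_nbhd ?G x \<inter> T0) = card (closed_nbhd ?G x \<inter> T1)"
    proof -
      consider "card (closed_nbhd ?G x \<inter> T0) = 1 \<and> card (closed_nbhd ?G x \<inter> T1) = 1"
        | "closed_nbhd ?G x \<inter> (T0 \<union> T1) = {}"
        using bt x unfolding perfect_bitrade_def by blast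
      then show ?thesis
      proof cases
        case 2
        then have "closed_nbhd ?G x \<inter> T0 = {}" "closed_nbhd ?G x \<inter> T1 = {}" by blast+
        then show ?thesis by simp
      qed simp
    qed
    ultimately show ?thesis by simp
  qed
  have eig: "(\<Sum>x\<in>closed_nbhd ?G y. ?\<chi> x) = c * ?\<chi> y" if y: "y \<in> ?V" for y
  proof -
    have "y \<notin> neighbors ?G y" by (simp add: neighbors_def adj_hamming_graph_irrefl)
    then have "(\<Sum>x\<in>closed_nbhd ?G y. ?\<chi> x) = ?\<chi> y + (\<Sum>x\<in>neighbors ?G y. ?\<chi> x)"
      by (simp add: closed_nbhd_def finite_neighbors_hamming)
    then show ?thesis
      using sum_neighbors_character[OF y W u] by (simp add: c_def algebra_simps)
  qed
  have "0 = (\<Sum>x\<in>?V. \<Sum>y\<in>closed_nbhd ?G x. ?\<chi> x * f y)"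
    using balance by (simp flip: sum_distrib_left)
  also have "\<dots> = (\<Sum>x\<in>?V. \<Sum>y | y \<in> ?V \<and> (y = x \<or> adj ?G x y). ?\<chi> x * f y)"
    using cn by simp
  also have "\<dots> = (\<Sum>y\<in>?V. \<Sum>x | x \<in> ?V \<and> (y = x \<or> adj ?G x y). ?\<chi> x * f y)"
    using finV by (rule sum.swap_restrict[OF _ finV])
  also have "\<dots> = (\<Sum>y\<in>?V. \<Sum>x\<in>closed_nbhd ?G y. ?\<chi> x * f y)"
    using cn by (intro sum.cong) (auto simp: adj_hamming_graph_sym)
  also have "\<dots> = (\<Sum>y\<in>?V. c * ?\<chi> y * f y)"
    by (simp add: eig flip: sum_distrib_right)
  also have "\<dots> = c * (\<Sum>y\<in>?V. f y * ?\<chi> y)"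
    by (simp add: sum_distrib_left mult_ac)
  finally show ?thesis using weight by (simp add: c_def f_def)
qed

lemma bij_betw_words_verts:
  "bij_betw (\<lambda>y. map y [0..<n]) (words q {..<n}) (verts (hamming_graph n q))"
proof (rule bij_betwI[where g = "\<lambda>x. \<lambda>r\<in>{..<n}. x ! r"])
  show "(\<lambda>y. map y [0..<n]) \<in> words q {..<n} \<rightarrow> verts (hamming_graph n q)"
  proof
    fix y assume y: "y \<in> words q {..<n}"
    have "y r < q" if "r < n" for r
      using PiE_mem[OF y[unfolded words_def], of r] that by simp
    then show "map y [0..<n] \<in> verts (hamming_graph n q)"
      by (auto simp: verts_hamming_iff)
  qed
  show "(\<lambda>x. \<lambda>r\<in>{..<n}. x ! r) \<in> verts (hamming_graph n q) \<rightarrow> words q {..<n}"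
  proof
    fix x assume "x \<in> verts (hamming_graph n q)"
    then have "x ! r \<in> {..<q}" if "r < n" for r
      using that nth_mem[of r x] unfolding verts_hamming_iff by blast
    then show "(\<lambda>r\<in>{..<n}. x ! r) \<in> words q {..<n}"
      unfolding words_def by (intro restrict_PiE_iff[THEN iffD2] ballI) simp
  qed
  show "(\<lambda>r\<in>{..<n}. map y [0..<n] ! r) = y" if "y \<in> words q {..<n}" for y
  proof
    show "(\<lambda>r\<in>{..<n}. map y [0..<n] ! r) r = y r" for r
      using that PiE_arb[of y "{..<n}" "\<lambda>_. {..<q}" r] by (cases "r < n") (simp_all add: words_def)
  qed
  show "map (\<lambda>r\<in>{..<n}. x ! r) [0..<n] = x" if "x \<in> verts (hamming_graph n q)" for x
  proof (rule nth_equalityI)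
    show len: "length (map (\<lambda>r\<in>{..<n}. x ! r) [0..<n]) = length x"
      using that by (simp add: verts_hamming_iff)
    show "map (\<lambda>r\<in>{..<n}. x ! r) [0..<n] ! i = x ! i"
      if "i < length (map (\<lambda>r\<in>{..<n}. x ! r) [0..<n])" for i
      using that by simp
  qed
qed

text \<open>
  The equation for \<open>i\<close> says that \<open>-1\<close> is the eigenvalue \<open>n * (q - 1) - q * i\<close>.
\<close>

theorem bitrade_size_bound:
  assumes bt: "perfect_bitrade (hamming_graph n q) T0 T1"
    and i: "n * (q - 1) + 1 = q * i" and q: "0 < q" and d: "n = i + d" "d \<le> i"
  shows "q ^ d * 2 ^ (i - d) \<le> bitrade_size T0 T1"
proof -
  let ?V = "verts (hamming_graph n q)"
  define F :: "(nat \<Rightarrow> nat) \<Rightarrow> int" where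
    "F y = of_bool (map y [0..<n] \<in> T0) - of_bool (map y [0..<n] \<in> T1)" for y
  have T: "T0 \<subseteq> ?V" "T1 \<subseteq> ?V" "T0 \<noteq> {}" "T0 \<inter> T1 = {}"
    using bt by (auto simp: perfect_bitrade_def)
  have supp: "support q {..<n} F = {y \<in> words q {..<n}. map y [0..<n] \<in> T0 \<union> T1}"
    using T(4) by (auto simp: support_def F_def of_bool_def)
  have bij: "bij_betw (\<lambda>y. map y [0..<n]) (support q {..<n} F) (T0 \<union> T1)"
  proof (rule bij_betw_subset[OF bij_betw_words_verts])
    show "support q {..<n} F \<subseteq> words q {..<n}" by (simp add: supp)
    have "(\<lambda>y. map y [0..<n]) ` support q {..<n} F =
        (\<lambda>y. map y [0..<n]) ` words q {..<n} \<inter> (T0 \<union> T1)"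
      unfolding supp by blast
    also have "\<dots> = T0 \<union> T1"
      using bij_betw_words_verts[of n q] T(1,2) unfolding bij_betw_def by blast
    finally show "(\<lambda>y. map y [0..<n]) ` support q {..<n} F = T0 \<union> T1" .
  qed
  have "spectral q {..<n} i d F"
    unfolding spectral_def
  proof (intro allI impI)
    fix W u
    assume W: "W \<subseteq> {..<n}" and u: "\<forall>r\<in>W. (\<Sum>a<q. u r a) = (0::int)"
      and small: "card W < i \<or> card ({..<n} - W) < d"
    have "card W \<noteq> i"
      using small W d(1) by (auto simp: card_Diff_subset finite_subset)
    moreover have "int n * (int q - 1) + 1 = int q * int i"
      using arg_cong[OF i, of int] q by (simp add: of_nat_diff)
    ultimately have ne: "int n * (int q - 1) + 1 \<noteq> int q * int (card W)" using q by simp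
    have "corr q {..<n} W u F = (\<Sum>y\<in>words q {..<n}.
      (of_bool (map y [0..<n] \<in> T0) - of_bool (map y [0..<n] \<in> T1)) *
        (\<Prod>r\<in>W. u r (map y [0..<n] ! r)))"
      unfolding corr_def F_def using W by (intro sum.cong refl arg_cong2[of _ _ _ _ "(*)"] prod.cong) auto
    also have "\<dots> = (\<Sum>x\<in>?V. (of_bool (x \<in> T0) - of_bool (x \<in> T1)) * (\<Prod>r\<in>W. u r (x ! r)))"
      by (rule sum.reindex_bij_betw[OF bij_betw_words_verts])
    also have "\<dots> = 0"
      using bitrade_orthogonal_character[OF bt W _ ne] u by blast
    finally show "corr q {..<n} W u F = 0" .
  qed
  moreover have "support q {..<n} F \<noteq> {}"
    using bij_betw_imp_surj_on[OF bij] T(3) by blast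
  ultimately have "q ^ d * 2 ^ (i - d) \<le> card (support q {..<n} F)"
    using d(2) by (intro support_bound) auto
  also have "\<dots> = card (T0 \<union> T1)" by (rule bij_betw_same_card[OF bij])
  also have "\<dots> = bitrade_size T0 T1"
    using T finite_subset[OF _ finite_verts_hamming_graph[of n q]]
    unfolding bitrade_size_def by (intro card_Un_disjoint) auto
  finally show ?thesis .
qed

section \<open>A bitrade from signs of permutations\<close>

text \<open>
  On letters \<open>0, 1, 2\<close> this is twice the sign of the permutation \<open>(a, b, c)\<close>, and zero if two letters
  agree. Only the sign of the value matters below.
\<close>

fun vandermonde :: "nat \<times> nat \<times> nat \<Rightarrow> int" where
  "vandermonde (a, b, c) = (int b - int a) * (int c - int a) * (int c - int b)"

fun signed_word :: "nat \<Rightarrow> nat list \<Rightarrow> int" where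
  "signed_word 0 [a] = 1 - int a"
| "signed_word (Suc m) (a # b # c # x) = vandermonde (a, b, c) * signed_word m x"
| "signed_word _ _ = 0"

fun prepend :: "nat \<times> nat \<times> nat \<Rightarrow> nat list \<Rightarrow> nat list" where
  "prepend (a, b, c) x = a # b # c # x"

definition triples :: "(nat \<times> nat \<times> nat) list" where
  "triples = List.product [0..<3] (List.product [0..<3] [0..<3])"

text \<open>
  The closed neighbourhood of a triple in \<open>H(3, 3)\<close>, as a list (with repetitions of the triple
  itself) so that statements about it reduce to a finite computation.
\<close>

fun triple_nbhd :: "nat \<times> nat \<times> nat \<Rightarrow> (nat \<times> nat \<times> nat) list" where
  "triple_nbhd (a, b, c) =
     map (\<lambda>t. (t, b, c)) [0..<3] @ map (\<lambda>t. (a, t, c)) [0..<3] @ map (\<lambda>t. (a, b, t)) [0..<3]"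

lemma lessThan_3: "{..<3} = {0, 1, 2::nat}"
  by (auto simp: less_Suc_eq numeral_3_eq_3)

lemma set_triples: "(a, b, c) \<in> set triples \<longleftrightarrow> a < 3 \<and> b < 3 \<and> c < 3"
  by (simp add: triples_def)

lemma signed_word_prepend:
  "signed_word (Suc m) (prepend p x) = vandermonde p * signed_word m x"
  by (cases p) simp

lemma inj_prepend: "prepend p x = prepend p' x' \<longleftrightarrow> p = p' \<and> x = x'"
  by (cases p; cases p') auto

lemma verts_Suc_prepend:
  "verts (hamming_graph (3 * Suc m + 1) 3) =
    (\<lambda>(p, x). prepend p x) ` (set triples \<times> verts (hamming_graph (3 * m + 1) 3))"
proof (intro equalityI subsetI)
  fix w assume w: "w \<in> verts (hamming_graph (3 * Suc m + 1) 3)"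
  then have "length w = Suc (Suc (Suc (3 * m + 1)))" by (simp add: verts_hamming_iff)
  then obtain a b c x where abc: "w = a # b # c # x" by (metis Suc_length_conv)
  then have "w = (\<lambda>(p, x). prepend p x) ((a, b, c), x)" by simp
  moreover have "((a, b, c), x) \<in> set triples \<times> verts (hamming_graph (3 * m + 1) 3)"
    using w by (simp add: abc verts_hamming_iff set_triples)
  ultimately show "w \<in> (\<lambda>(p, x). prepend p x) ` (set triples \<times> verts (hamming_graph (3 * m + 1) 3))"
    by (rule image_eqI)
next
  fix w assume "w \<in> (\<lambda>(p, x). prepend p x) ` (set triples \<times> verts (hamming_graph (3 * m + 1) 3))"
  then obtain a b c x where "w = a # b # c # x" "(a, b, c) \<in> set triples"
    "x \<in> verts (hamming_graph (3 * m + 1) 3)"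
    by force
  then show "w \<in> verts (hamming_graph (3 * Suc m + 1) 3)"
    by (simp add: verts_hamming_iff set_triples)
qed

lemma closed_nbhd_hamming_Cons:
  assumes "a < q" "x \<in> verts (hamming_graph n q)"
  shows "closed_nbhd (hamming_graph (Suc n) q) (a # x) =
    (#) a ` closed_nbhd (hamming_graph n q) x \<union> (\<lambda>b. b # x) ` {..<q}"
  using assms neighbors_hamming_Cons[of a x n q]
  by (auto simp: closed_nbhd_def Cons_verts_hamming)

lemma closed_nbhd_prepend:
  assumes "p \<in> set triples" "x \<in> verts (hamming_graph (3 * m + 1) 3)"
  shows "closed_nbhd (hamming_graph (3 * Suc m + 1) 3) (prepend p x) =
    prepend p ` closed_nbhd (hamming_graph (3 * m + 1) 3) x \<union>
    (\<lambda>p'. prepend p' x) ` set (triple_nbhd p)"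
proof (cases p)
  case (fields a b c)
  have abc: "a < 3" "b < 3" "c < 3" using assms(1) by (simp_all add: fields set_triples)
  have "set (triple_nbhd p) =
      (\<lambda>t. (t, b, c)) ` {..<3} \<union> (\<lambda>t. (a, t, c)) ` {..<3} \<union> (\<lambda>t. (a, b, t)) ` {..<3}"
    by (simp add: fields lessThan_atLeast0 Un_assoc)
  then have triple: "(\<lambda>p'. prepend p' x) ` set (triple_nbhd p) =
      (\<lambda>t. t # b # c # x) ` {..<3} \<union> (\<lambda>t. a # t # c # x) ` {..<3} \<union> (\<lambda>t. a # b # t # x) ` {..<3}"
    by (simp only: image_Un image_image prepend.simps)
  have "closed_nbhd (hamming_graph (Suc (Suc (Suc n))) 3) (a # b # c # x) =
      (#) a ` ((#) b ` ((#) c ` closed_nbhd (hamming_graph n 3) x \<union>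
        (\<lambda>t. t # x) ` {..<3}) \<union> (\<lambda>t. t # c # x) ` {..<3}) \<union> (\<lambda>t. t # b # c # x) ` {..<3}"
    if "x \<in> verts (hamming_graph n 3)" for n
    using abc that by (simp only: closed_nbhd_hamming_Cons Cons_verts_hamming simp_thms)
  moreover have "3 * Suc m + 1 = Suc (Suc (Suc (3 * m + 1)))" by simp
  ultimately have "closed_nbhd (hamming_graph (3 * Suc m + 1) 3) (a # b # c # x) =
      (\<lambda>z. a # b # c # z) ` closed_nbhd (hamming_graph (3 * m + 1) 3) x \<union>
      ((\<lambda>t. t # b # c # x) ` {..<3} \<union> (\<lambda>t. a # t # c # x) ` {..<3} \<union> (\<lambda>t. a # b # t # x) ` {..<3})"
    using assms(2) by (simp only: image_Un image_image Un_ac)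
  then show ?thesis
    unfolding triple by (simp add: fields)
qed

text \<open>
  A change of one letter destroys a permutation.
\<close>

lemma vandermonde_nbhd_nonzero:
  assumes "p \<in> set triples" "p' \<in> set (triple_nbhd p)" "vandermonde p \<noteq> 0" "vandermonde p' \<noteq> 0"
  shows "p' = p"
proof -
  have "\<forall>p\<in>set triples. vandermonde p \<noteq> 0 \<longrightarrow>
      (\<forall>p'\<in>set (triple_nbhd p). vandermonde p' \<noteq> 0 \<longrightarrow> p' = p)"
    by code_simp
  then show ?thesis using assms by blast
qed

text \<open>
  If exactly two letters agree, replacing either of them by the missing letter gives a permutation,
  and the two results differ by a transposition. If all three agree, two changes are needed.
\<close>

lemma vandermonde_nbhd_balanced:
  assumes "p \<in> set triples" "vandermonde p = 0"
  shows "(card {p' \<in> set (triple_nbhd p). 0 < vandermonde p'} = 1 \<and>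
      card {p' \<in> set (triple_nbhd p). vandermonde p' < 0} = 1) \<or>
    (\<forall>p'\<in>set (triple_nbhd p). vandermonde p' = 0)"
proof -
  have "\<forall>p\<in>set triples. vandermonde p = 0 \<longrightarrow>
     (card (set (filter (\<lambda>p'. 0 < vandermonde p') (triple_nbhd p))) = 1 \<and>
      card (set (filter (\<lambda>p'. vandermonde p' < 0) (triple_nbhd p))) = 1) \<or>
     (\<forall>p'\<in>set (triple_nbhd p). vandermonde p' = 0)"
    by code_simp
  then show ?thesis using assms by simp
qed

lemma card_nonzero_triples: "card {p \<in> set triples. vandermonde p \<noteq> 0} = 6"
proof -
  have "card (set (filter (\<lambda>p. vandermonde p \<noteq> 0) triples)) = 6"
    by code_simp
  then show ?thesis by simp
qed

lemma card_signed_word_nonzero: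
  "card {x \<in> verts (hamming_graph (3 * m + 1) 3). signed_word m x \<noteq> 0} = 2 * 6 ^ m"
proof (induction m)
  case 0
  have "{x \<in> verts (hamming_graph 1 3). signed_word 0 x \<noteq> 0} = {[0], [2]}"
  proof (intro equalityI subsetI)
    fix x assume x: "x \<in> {x \<in> verts (hamming_graph 1 3). signed_word 0 x \<noteq> 0}"
    then obtain a where "x = [a]" by (auto simp: verts_hamming_iff length_Suc_conv)
    with x show "x \<in> {[0], [2]}" by (auto simp: verts_hamming_iff)
  qed (auto simp: verts_hamming_iff)
  then show ?case by simp
next
  case (Suc m)
  let ?S = "{x \<in> verts (hamming_graph (3 * m + 1) 3). signed_word m x \<noteq> 0}"
  have "{x \<in> verts (hamming_graph (3 * Suc m + 1) 3). signed_word (Suc m) x \<noteq> 0} =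
      (\<lambda>(p, x). prepend p x) ` ({p \<in> set triples. vandermonde p \<noteq> 0} \<times> ?S)"
    unfolding verts_Suc_prepend
    by (auto simp: signed_word_prepend simp del: signed_word.simps prepend.simps vandermonde.simps)
  moreover have "inj_on (\<lambda>(p, x). prepend p x) A" for A
    by (auto simp: inj_on_def inj_prepend simp del: prepend.simps)
  ultimately show ?case
    using Suc.IH by (simp only: card_image card_cartesian_product card_nonzero_triples) simp
qed

text \<open>
  If the first triple is a permutation, nonzero values near the word occur only where this triple is
  unchanged, and the claim for the remaining letters applies, with both signs exchanged for an odd
  permutation. Otherwise they occur only where the remaining letters are unchanged, and the triple
  itself decides.
\<close>

lemma signed_word_nbhd:
  assumes "x \<in> verts (hamming_graph (3 * m + 1) 3)"
  shows "(card {y \<in> closed_nbhd (hamming_graph (3 * m + 1) 3) x. 0 < signed_word m y} = 1 \<and>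
      card {y \<in> closed_nbhd (hamming_graph (3 * m + 1) 3) x. signed_word m y < 0} = 1) \<or>
    (\<forall>y\<in>closed_nbhd (hamming_graph (3 * m + 1) 3) x. signed_word m y = 0)"
  using assms
proof (induction m arbitrary: x)
  case 0
  then obtain a where x: "x = [a]" "a < 3"
    by (auto simp: verts_hamming_iff length_Suc_conv)
  have "closed_nbhd (hamming_graph 0 3) [] = {[]}"
    by (auto simp: closed_nbhd_def neighbors_def adj_def hamming_graph_def)
  then have "closed_nbhd (hamming_graph (3 * 0 + 1) 3) x = {[a]} \<union> (\<lambda>b. [b]) ` {..<3}"
    using closed_nbhd_hamming_Cons[of a 3 "[]" 0] x by (simp add: verts_hamming_iff)
  also have "\<dots> = (\<lambda>b. [b]) ` {..<3}" using x(2) by blast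
  also have "\<dots> = {[0], [1], [2]}" by (simp add: lessThan_3)
  finally have "closed_nbhd (hamming_graph (3 * 0 + 1) 3) x = {[0], [1], [2]}" .
  moreover have "{y \<in> {[0], [1], [2]}. 0 < signed_word 0 y} = {[0]}"
    "{y \<in> {[0], [1], [2]}. signed_word 0 y < 0} = {[2]}"
    by auto
  ultimately show ?case by simp
next
  case (Suc m)
  let ?N = "closed_nbhd (hamming_graph (3 * m + 1) 3)"
  let ?N' = "closed_nbhd (hamming_graph (3 * Suc m + 1) 3)"
  obtain p y where x: "x = prepend p y" and p: "p \<in> set triples"
    and y: "y \<in> verts (hamming_graph (3 * m + 1) 3)"
    using Suc.prems unfolding verts_Suc_prepend by auto
  have N': "?N' x = prepend p ` ?N y \<union> (\<lambda>p'. prepend p' y) ` set (triple_nbhd p)"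
    unfolding x by (rule closed_nbhd_prepend[OF p y])
  have yN: "y \<in> ?N y" by (simp add: closed_nbhd_def)
  have inj1: "inj_on (prepend p) A" for A by (simp add: inj_on_def inj_prepend)
  have inj2: "inj_on (\<lambda>p'. prepend p' y) A" for A by (simp add: inj_on_def inj_prepend)
  show ?case
  proof (cases "vandermonde p = 0")
    case False
    have part: "{z \<in> ?N' x. P (signed_word (Suc m) z)} =
        prepend p ` {z \<in> ?N y. P (vandermonde p * signed_word m z)}" if "\<not> P 0" for P
    proof (intro equalityI subsetI)
      fix z assume z: "z \<in> {z \<in> ?N' x. P (signed_word (Suc m) z)}"
      then consider w where "w \<in> ?N y" "z = prepend p w"
        | p' where "p' \<in> set (triple_nbhd p)" "z = prepend p' y"
        unfolding N' by blast
      then show "z \<in> prepend p ` {z \<in> ?N y. P (vandermonde p * signed_word m z)}"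
      proof cases
        case 1
        then show ?thesis using z by (simp add: signed_word_prepend)
      next
        case 2
        then have P: "P (vandermonde p' * signed_word m y)"
          using z by (simp add: signed_word_prepend)
        then have "vandermonde p' \<noteq> 0" using that by (metis mult_zero_left)
        then have "p' = p" using vandermonde_nbhd_nonzero[OF p 2(1) False] by blast
        then show ?thesis using P 2(2) yN by blast
      qed
    next
      fix z assume "z \<in> prepend p ` {z \<in> ?N y. P (vandermonde p * signed_word m z)}"
      then obtain w where "z = prepend p w" "w \<in> ?N y" "P (vandermonde p * signed_word m w)"
        by blast
      then show "z \<in> {z \<in> ?N' x. P (signed_word (Suc m) z)}"
        unfolding N' by (simp add: signed_word_prepend)
    qed
    have *: "card {z \<in> ?N' x. P (signed_word (Suc m) z)} =
        card {z \<in> ?N y. P (vandermonde p * signed_word m z)}" if "\<not> P 0" for P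
      unfolding part[of P, OF that] by (rule card_image[OF inj1])
    have pos: "card {z \<in> ?N' x. 0 < signed_word (Suc m) z} =
        card {z \<in> ?N y. 0 < (vandermonde p * signed_word m z)}"
      by (rule *) simp
    have neg: "card {z \<in> ?N' x. signed_word (Suc m) z < 0} =
        card {z \<in> ?N y. (vandermonde p * signed_word m z) < 0}"
      by (rule *) simp
    have zero: "(\<forall>z\<in>?N' x. signed_word (Suc m) z = 0) \<longleftrightarrow> (\<forall>z\<in>?N y. signed_word m z = 0)"
      using part[of "\<lambda>t. t \<noteq> 0"] False by auto
    show ?thesis
    proof (cases "0 < vandermonde p")
      case True
      then show ?thesis
        using Suc.IH[OF y] unfolding zero pos neg
        by (simp add: zero_less_mult_iff mult_less_0_iff)
    next
      case nonpos: False
      with False have "vandermonde p < 0" by simp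
      then show ?thesis
        using Suc.IH[OF y] unfolding zero pos neg
        by (simp add: zero_less_mult_iff mult_less_0_iff) blast
    qed
  next
    case True
    have part: "{z \<in> ?N' x. P (signed_word (Suc m) z)} =
        (\<lambda>p'. prepend p' y) ` {p' \<in> set (triple_nbhd p). P (vandermonde p' * signed_word m y)}"
      if "\<not> P 0" for P
    proof (intro equalityI subsetI)
      fix z assume z: "z \<in> {z \<in> ?N' x. P (signed_word (Suc m) z)}"
      have "signed_word (Suc m) (prepend p w) = 0" for w
        by (simp only: signed_word_prepend True mult_zero_left)
      then have "z \<noteq> prepend p w" for w
        using z that by (metis (mono_tags, lifting) mem_Collect_eq)
      then obtain p' where "p' \<in> set (triple_nbhd p)" "z = prepend p' y"
        using z unfolding N' by blast
      then show "z \<in> (\<lambda>p'. prepend p' y) `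
          {p' \<in> set (triple_nbhd p). P (vandermonde p' * signed_word m y)}"
        using z by (simp add: signed_word_prepend)
    next
      fix z assume "z \<in> (\<lambda>p'. prepend p' y) `
          {p' \<in> set (triple_nbhd p). P (vandermonde p' * signed_word m y)}"
      then obtain p' where "z = prepend p' y" "p' \<in> set (triple_nbhd p)"
        "P (vandermonde p' * signed_word m y)"
        by blast
      then show "z \<in> {z \<in> ?N' x. P (signed_word (Suc m) z)}"
        unfolding N' by (simp add: signed_word_prepend)
    qed
    have *: "card {z \<in> ?N' x. P (signed_word (Suc m) z)} =
        card {p' \<in> set (triple_nbhd p). P (vandermonde p' * signed_word m y)}" if "\<not> P 0" for P
      unfolding part[of P, OF that] by (rule card_image[OF inj2])
    have pos: "card {z \<in> ?N' x. 0 < signed_word (Suc m) z} =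
        card {p' \<in> set (triple_nbhd p). 0 < (vandermonde p' * signed_word m y)}"
      by (rule *) simp
    have neg: "card {z \<in> ?N' x. signed_word (Suc m) z < 0} =
        card {p' \<in> set (triple_nbhd p). (vandermonde p' * signed_word m y) < 0}"
      by (rule *) simp
    have zero: "(\<forall>z\<in>?N' x. signed_word (Suc m) z = 0) \<longleftrightarrow>
        (\<forall>p'\<in>set (triple_nbhd p). vandermonde p' * signed_word m y = 0)"
      using part[of "\<lambda>t. t \<noteq> 0"] by auto
    show ?thesis
      using vandermonde_nbhd_balanced[OF p True]
      unfolding zero pos neg
      by (cases "signed_word m y" "0::int" rule: linorder_cases)
         (simp_all add: zero_less_mult_iff mult_less_0_iff conj_commute)
  qed
qed

lemma minimum_bitrade_exists:
  "\<exists>T0 T1. perfect_bitrade (hamming_graph (3 * m + 1) 3) T0 T1 \<and>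
    bitrade_size T0 T1 = 2 ^ (m + 1) * 3 ^ m"
proof -
  let ?G = "hamming_graph (3 * m + 1) 3"
  let ?V = "verts ?G"
  define T0 where "T0 = {x \<in> ?V. 0 < signed_word m x}"
  define T1 where "T1 = {x \<in> ?V. signed_word m x < 0}"
  have sub: "closed_nbhd ?G x \<subseteq> ?V" if "x \<in> ?V" for x
    using that by (auto simp: closed_nbhd_def neighbors_def)
  have meets: "closed_nbhd ?G x \<inter> T0 = {y \<in> closed_nbhd ?G x. 0 < signed_word m y}"
    "closed_nbhd ?G x \<inter> T1 = {y \<in> closed_nbhd ?G x. signed_word m y < 0}" if "x \<in> ?V" for x
    using sub[OF that] by (auto simp: T0_def T1_def)
  have local: "card (closed_nbhd ?G x \<inter> T0) = 1 \<and> card (closed_nbhd ?G x \<inter> T1) = 1 \<or>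
      closed_nbhd ?G x \<inter> (T0 \<union> T1) = {}" if x: "x \<in> ?V" for x
    using signed_word_nbhd[OF x] unfolding meets[OF x, symmetric]
    by (auto simp: T0_def T1_def)
  have union: "T0 \<union> T1 = {x \<in> ?V. signed_word m x \<noteq> 0}"
    by (auto simp: T0_def T1_def)
  have disj: "T0 \<inter> T1 = {}" by (auto simp: T0_def T1_def)
  have fin: "finite T0" "finite T1"
    using finite_verts_hamming_graph[of "3 * m + 1" 3] by (simp_all add: T0_def T1_def)
  have size: "bitrade_size T0 T1 = 2 * 6 ^ m"
    unfolding bitrade_size_def card_Un_disjoint[OF fin disj, symmetric] union
    by (rule card_signed_word_nonzero)
  have "T0 \<union> T1 \<noteq> {}"
    using size by (auto simp: bitrade_size_def)
  then obtain x where x: "x \<in> T0 \<union> T1" by blast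
  then have xV: "x \<in> ?V" by (auto simp: T0_def T1_def)
  have "x \<in> closed_nbhd ?G x" by (simp add: closed_nbhd_def)
  then have "card (closed_nbhd ?G x \<inter> T0) = 1" "card (closed_nbhd ?G x \<inter> T1) = 1"
    using local[OF xV] x by blast+
  then have "T0 \<noteq> {}" "T1 \<noteq> {}" by auto
  then have "perfect_bitrade ?G T0 T1"
    using local disj by (auto simp: perfect_bitrade_def T0_def T1_def)
  moreover have "(2::nat) * 6 ^ m = 2 ^ (m + 1) * 3 ^ m"
    by (simp flip: power_mult_distrib)
  ultimately show ?thesis using size by metis
qed

theorem theorem7:
  fixes m :: nat
  assumes "m \<ge> 1"
  shows "(\<exists>T0 T1. perfect_bitrade (hamming_graph (3 * m + 1) 3) T0 T1 \<and>
            bitrade_size T0 T1 = 2 ^ (m + 1) * 3 ^ m) \<and>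
         (\<forall>T0 T1. perfect_bitrade (hamming_graph (3 * m + 1) 3) T0 T1 \<longrightarrow>
            bitrade_size T0 T1 \<ge> 2 ^ (m + 1) * 3 ^ m)"
proof (intro conjI allI impI)
  show "\<exists>T0 T1. perfect_bitrade (hamming_graph (3 * m + 1) 3) T0 T1 \<and>
      bitrade_size T0 T1 = 2 ^ (m + 1) * 3 ^ m"
    by (rule minimum_bitrade_exists)
  show "2 ^ (m + 1) * 3 ^ m \<le> bitrade_size T0 T1"
    if "perfect_bitrade (hamming_graph (3 * m + 1) 3) T0 T1" for T0 T1
    using bitrade_size_bound[OF that, of "2 * m + 1" m] by (simp add: mult.commute)
qed

end
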